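(* Let $k\ge 2$ and $n\ge 1$ be integers and consider a transversal design $\mathrm{TD}(k,n)$. Breaker has a winning strategy in the Maker-Breaker game on it whenever $n\le 2^{k/2}-\tfrac12$, and Maker has a winning strategy whenever $n>k\,2^{k-3}$.
   Context: A transversal design $\mathrm{TD}(k,n)$ is a triple $(X,\mathcal{G},\mathcal{B})$ where $X$ is a set of $kn$ points, $\mathcal{G}$ is a partition of $X$ into $k$ subsets of cardinality $n$ (the groups), and $\mathcal{B}$ is a set of $k$-element subsets of $X$ (the blocks) such that every pair of points not in the same group appears in exactly one block, and no block contains two points of the same group. The Maker-Breaker game on a design: Maker and Breaker alternately choose points not chosen before, Maker moving first. Maker wins if he at some time has chosen all points of some block; Breaker wins if all points have been chosen and Maker has not completed a block. Only the blocks (not the groups) are winning sets. *)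

theory Defs
  imports Complex_Main "HOL-Library.Disjoint_Sets"
begin

locale transversal_design =
  fixes k n :: nat and X :: "'a set" and groups blocks :: "'a set set"
  assumes finite_points: "finite X"
    and card_points: "card X = k * n"
    and partition_groups: "partition_on X groups"
    and card_groups: "card groups = k"
    and card_group: "g \<in> groups \<Longrightarrow> card g = n"
    and block_subset: "b \<in> blocks \<Longrightarrow> b \<subseteq> X"
    and card_block: "b \<in> blocks \<Longrightarrow> card b = k"
    and pair_in_unique_block:
      "x \<in> X \<Longrightarrow> y \<in> X \<Longrightarrow> \<not> (\<exists>g\<in>groups. x \<in> g \<and> y \<in> g) \<Longrightarrow>
        \<exists>!b. b \<in> blocks \<and> x \<in> b \<and> y \<in> b"
    and block_meets_group:
      "b \<in> blocks \<Longrightarrow> g \<in> groups \<Longrightarrow> \<not> (\<exists>x y. x \<noteq> y \<and> {x, y} \<subseteq> b \<and> {x, y} \<subseteq> g)"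

text \<open>
  The Maker-Breaker game on a finite point set \<open>X\<close> with winning sets \<open>\<F>\<close>.
  A position is the list of the points chosen so far, in the order in which they were
  chosen, oldest first. Maker moves first, so the entries at even indices are Maker's and
  Maker is to move exactly at positions of even length. A play runs until all points
  have been chosen; this is harmless, since a block once completed by Maker stays completed.
\<close>

definition position :: "'a set \<Rightarrow> 'a list \<Rightarrow> bool" where
  "position X p \<longleftrightarrow> distinct p \<and> set p \<subseteq> X"

definition complete_play :: "'a set \<Rightarrow> 'a list \<Rightarrow> bool" where
  "complete_play X p \<longleftrightarrow> distinct p \<and> set p = X"

definition maker_points :: "'a list \<Rightarrow> 'a set" where
  "maker_points p = {p ! i | i. i < length p \<and> even i}"

definition maker_wins_play :: "'a set set \<Rightarrow> 'a list \<Rightarrow> bool" where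
  "maker_wins_play \<F> p \<longleftrightarrow> (\<exists>t\<le>length p. \<exists>b\<in>\<F>. b \<subseteq> maker_points (take t p))"

definition breaker_wins_play :: "'a set \<Rightarrow> 'a set set \<Rightarrow> 'a list \<Rightarrow> bool" where
  "breaker_wins_play X \<F> p \<longleftrightarrow> complete_play X p \<and> \<not> (\<exists>b\<in>\<F>. b \<subseteq> maker_points p)"

text \<open>
  A strategy must prescribe a legal move at every non-final position where its owner is to
  move; without this a strategy could be vacuously winning by admitting no complete play.
\<close>

definition maker_strategy :: "'a set \<Rightarrow> ('a list \<Rightarrow> 'a) \<Rightarrow> bool" where
  "maker_strategy X \<sigma> \<longleftrightarrow>
    (\<forall>p. position X p \<and> set p \<noteq> X \<and> even (length p) \<longrightarrow> \<sigma> p \<in> X - set p)"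

definition breaker_strategy :: "'a set \<Rightarrow> ('a list \<Rightarrow> 'a) \<Rightarrow> bool" where
  "breaker_strategy X \<sigma> \<longleftrightarrow>
    (\<forall>p. position X p \<and> set p \<noteq> X \<and> odd (length p) \<longrightarrow> \<sigma> p \<in> X - set p)"

definition maker_follows :: "('a list \<Rightarrow> 'a) \<Rightarrow> 'a list \<Rightarrow> bool" where
  "maker_follows \<sigma> p \<longleftrightarrow> (\<forall>i<length p. even i \<longrightarrow> p ! i = \<sigma> (take i p))"

definition breaker_follows :: "('a list \<Rightarrow> 'a) \<Rightarrow> 'a list \<Rightarrow> bool" where
  "breaker_follows \<sigma> p \<longleftrightarrow> (\<forall>i<length p. odd i \<longrightarrow> p ! i = \<sigma> (take i p))"

definition maker_has_winning_strategy :: "'a set \<Rightarrow> 'a set set \<Rightarrow> bool" where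
  "maker_has_winning_strategy X \<F> \<longleftrightarrow>
    (\<exists>\<sigma>. maker_strategy X \<sigma> \<and>
      (\<forall>p. complete_play X p \<and> maker_follows \<sigma> p \<longrightarrow> maker_wins_play \<F> p))"

definition breaker_has_winning_strategy :: "'a set \<Rightarrow> 'a set set \<Rightarrow> bool" where
  "breaker_has_winning_strategy X \<F> \<longleftrightarrow>
    (\<exists>\<sigma>. breaker_strategy X \<sigma> \<and>
      (\<forall>p. complete_play X p \<and> breaker_follows \<sigma> p \<longrightarrow> breaker_wins_play X \<F> p))"

end

theory Submission
  imports Defs
begin

text \<open>
  Weigh a block that Breaker has not touched by \<open>2\<^sup>-\<^sup>j\<close>, where \<open>j\<close> is the number of its points
  that Maker still lacks, and let both players greedily choose a point lying on blocks of
  largest total weight. If Breaker is greedy, a Breaker move followed by a Maker move never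
  increases the total weight (Erdos and Selfridge); after Maker's first move it is
  \<open>(n\<^sup>2 + n) / 2\<^sup>k\<close>, and below \<open>1\<close> no block can be complete. If Maker is greedy, a Maker move
  followed by a Breaker move costs at most the weight of the unique block through the two
  chosen points, hence at most \<open>1/4\<close> (Beck); as there are at most \<open>k n / 2\<close> such rounds and the
  weight is initially \<open>n\<^sup>2 / 2\<^sup>k\<close>, some block remains untouched by Breaker at the end.
\<close>

section \<open>The potential\<close>

definition breaker_points :: "'a list \<Rightarrow> 'a set" where
  "breaker_points p = {p ! i | i. i < length p \<and> odd i}"

text \<open>The family is an argument because the potential of \<open>through x \<F>\<close> is also
  needed: it is both what Maker gains and what Breaker destroys by choosing
  \<open>x\<close>.\<close>

definition potential :: "'a set set \<Rightarrow> 'a set \<Rightarrow> 'a set \<Rightarrow> real" where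
  "potential \<F> M B = (\<Sum>b | b \<in> \<F> \<and> b \<inter> B = {}. (1/2) ^ card (b - M))"

definition through :: "'a \<Rightarrow> 'a set set \<Rightarrow> 'a set set" where
  "through x \<F> = {b \<in> \<F>. x \<in> b}"

text \<open>An arbitrary index predicate \<open>P\<close> lets one proof serve both parities, hence
  both players.\<close>

lemma nth_image_snoc:
  "{(p @ [x]) ! i | i. i < length (p @ [x]) \<and> P i} =
    (if P (length p) then insert x {p ! i | i. i < length p \<and> P i} else {p ! i | i. i < length p \<and> P i})"
proof -
  have *: "{q ! i | i. i < length q \<and> P i} = (!) q ` {i. i < length q \<and> P i}" for q :: "'a list"
    by (auto simp only:)
  have "{i. i < length (p @ [x]) \<and> P i} =
      (if P (length p) then insert (length p) {i. i < length p \<and> P i} else {i. i < length p \<and> P i})"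
    by (auto simp: less_Suc_eq)
  moreover have "(!) (p @ [x]) ` {i. i < length p \<and> P i} = (!) p ` {i. i < length p \<and> P i}"
    by (intro image_cong) (auto simp: nth_append)
  ultimately show ?thesis unfolding * by simp
qed

lemma maker_points_snoc:
  "maker_points (p @ [x]) = (if even (length p) then insert x (maker_points p) else maker_points p)"
  unfolding maker_points_def by (rule nth_image_snoc)

lemma breaker_points_snoc:
  "breaker_points (p @ [x]) = (if odd (length p) then insert x (breaker_points p) else breaker_points p)"
  unfolding breaker_points_def by (rule nth_image_snoc)

lemma points_Nil [simp]: "maker_points [] = {}" "breaker_points [] = {}"
  by (auto simp: maker_points_def breaker_points_def)

lemma maker_Un_breaker_points: "maker_points p \<union> breaker_points p = set p"
  unfolding maker_points_def breaker_points_def set_conv_nth by blast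

lemma maker_Int_breaker_points: "distinct p \<Longrightarrow> maker_points p \<inter> breaker_points p = {}"
  by (auto simp: maker_points_def breaker_points_def nth_eq_iff_index_eq)

section \<open>Change of the potential under moves\<close>

lemma potential_nonneg: "potential \<F> M B \<ge> 0"
  unfolding potential_def by (intro sum_nonneg) auto

lemma finite_through [simp]: "finite \<F> \<Longrightarrow> finite (through x \<F>)"
  by (simp add: through_def)

text \<open>Each block through \<open>y\<close> now lacks one point fewer, so its weight doubles:
  the gain equals its old weight.\<close>

lemma potential_maker_move:
  assumes "finite \<F>" "\<And>b. b \<in> \<F> \<Longrightarrow> finite b" "y \<notin> M"
  shows "potential \<F> (insert y M) B = potential \<F> M B + potential (through y \<F>) M B"
proof -
  have *: "(1/2::real) ^ card (b - insert y M) =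
      (1/2) ^ card (b - M) + (if y \<in> b then (1/2) ^ card (b - M) else 0)" if "b \<in> \<F>" for b
  proof (cases "y \<in> b")
    case True
    have "b - insert y M = (b - M) - {y}" by auto
    moreover have "card (b - M) = Suc (card ((b - M) - {y}))"
      using True assms that by (subst card_Suc_Diff1) auto
    ultimately show ?thesis using True by simp
  qed (simp add: Diff_insert0)
  have "potential \<F> (insert y M) B = potential \<F> M B +
      (\<Sum>b | b \<in> \<F> \<and> b \<inter> B = {}. if y \<in> b then (1/2) ^ card (b - M) else 0)"
    unfolding potential_def sum.distrib[symmetric] by (intro sum.cong) (auto simp: *)
  also have "(\<Sum>b | b \<in> \<F> \<and> b \<inter> B = {}. if y \<in> b then (1/2) ^ card (b - M) else 0)
      = potential (through y \<F>) M B"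
    unfolding potential_def through_def using assms(1)
    by (subst sum.inter_filter[symmetric]) (auto intro!: sum.cong)
  finally show ?thesis .
qed

text \<open>The untouched blocks through \<open>z\<close> are exactly those that drop out of the
  sum.\<close>

lemma potential_breaker_move:
  assumes "finite \<F>"
  shows "potential \<F> M (insert z B) = potential \<F> M B - potential (through z \<F>) M B"
proof -
  have "{b. b \<in> \<F> \<and> b \<inter> B = {}} =
      {b. b \<in> \<F> \<and> b \<inter> insert z B = {}} \<union> {b. b \<in> through z \<F> \<and> b \<inter> B = {}}"
    by (auto simp: through_def)
  then have "potential \<F> M B = potential \<F> M (insert z B) + potential (through z \<F>) M B"
    unfolding potential_def using assms
    by (simp only:) (rule sum.union_disjoint, auto simp: through_def)
  then show ?thesis by simp
qed

text \<open>Doubling through \<open>y\<close> and deletion through \<open>z\<close> overlap on the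
  blocks through both, whose doubled weight is lost as well; the last term corrects for this. The
  formula does not depend on who moves first, so it serves both games.\<close>

lemma potential_round:
  assumes "finite \<F>" "\<And>b. b \<in> \<F> \<Longrightarrow> finite b" "y \<notin> M"
  shows "potential \<F> (insert y M) (insert z B) =
    potential \<F> M B + potential (through y \<F>) M B - potential (through z \<F>) M B
      - potential (through y (through z \<F>)) M B"
proof -
  have "b \<in> through z \<F> \<Longrightarrow> finite b" for b
    using assms by (auto simp: through_def)
  then show ?thesis
    using assms by (simp add: potential_breaker_move potential_maker_move)
qed

text \<open>A block through both points still lacks at least these two, so it weighs at most
  1/4.\<close>

lemma potential_through_pair_le:
  assumes "finite \<F>" "\<And>b. b \<in> \<F> \<Longrightarrow> finite b" "y \<notin> M" "z \<notin> M" "y \<noteq> z"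
    and "card (through y (through z \<F>)) \<le> D"
  shows "potential (through y (through z \<F>)) M B \<le> real D / 4"
proof -
  let ?S = "{b. b \<in> through y (through z \<F>) \<and> b \<inter> B = {}}"
  have "(1/2::real) ^ card (b - M) \<le> 1/4" if "b \<in> ?S" for b
  proof -
    from that have "{y, z} \<subseteq> b - M" "finite (b - M)"
      using assms by (auto simp: through_def)
    from card_mono[OF this(2,1)] have "card (b - M) \<ge> 2" using assms by simp
    then have "(1/2::real) ^ card (b - M) \<le> (1/2) ^ 2" by (intro power_decreasing) auto
    then show ?thesis by (simp add: power2_eq_square)
  qed
  then have "potential (through y (through z \<F>)) M B \<le> real (card ?S) * (1/4)"
    unfolding potential_def by (rule sum_bounded_above)
  also have "card ?S \<le> D"
    using assms by (intro order.trans[OF card_mono assms(6)]) auto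
  finally show ?thesis by simp
qed

section \<open>The greedy strategy\<close>

text \<open>One function serves both players, since the same weight measures Maker's gain and
  Breaker's removal. Once all points are chosen its value is arbitrary.\<close>

definition greedy :: "'a set \<Rightarrow> 'a set set \<Rightarrow> 'a list \<Rightarrow> 'a" where
  "greedy X \<F> p = arg_max_on
    (\<lambda>x. potential (through x \<F>) (maker_points p) (breaker_points p)) (X - set p)"

lemma greedy_is_arg_max:
  assumes "finite X" "X - set p \<noteq> {}"
  shows "is_arg_max (\<lambda>x. potential (through x \<F>) (maker_points p) (breaker_points p))
    (\<lambda>x. x \<in> X - set p) (greedy X \<F> p)"
proof -
  let ?w = "\<lambda>x. potential (through x \<F>) (maker_points p) (breaker_points p)"
  \<comment> \<open>A maximum on a finite nonempty set is obtained as a minimum of the negated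
    weight.\<close>
  have "\<exists>x. is_arg_min (\<lambda>x. - ?w x) (\<lambda>x. x \<in> X - set p) x"
    using assms by (intro ex_is_arg_min_if_finite) auto
  then have "\<exists>x. is_arg_max ?w (\<lambda>x. x \<in> X - set p) x"
    by (simp add: is_arg_min_def is_arg_max_def)
  then show ?thesis
    unfolding greedy_def arg_max_on_def arg_max_def by (rule someI_ex)
qed

lemma greedy_in:
  assumes "finite X" "position X p" "set p \<noteq> X"
  shows "greedy X \<F> p \<in> X - set p"
proof -
  have "X - set p \<noteq> {}" using assms by (auto simp: position_def)
  then show ?thesis
    using greedy_is_arg_max[OF assms(1), of p \<F>] by (simp add: is_arg_max_def)
qed

lemma greedy_max:
  assumes "finite X" "y \<in> X - set p"
  shows "potential (through y \<F>) (maker_points p) (breaker_points p)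
    \<le> potential (through (greedy X \<F> p) \<F>) (maker_points p) (breaker_points p)"
proof -
  have "X - set p \<noteq> {}" using assms by blast
  then show ?thesis
    using greedy_is_arg_max[OF assms(1), of p \<F>] assms(2) unfolding is_arg_max_linorder by blast
qed

section \<open>Winning criteria for arbitrary families of winning sets\<close>

lemma complete_play_nth_fresh:
  assumes "complete_play X p" "t < length p"
  shows "p ! t \<in> X - set (take t p)"
  using assms by (auto simp: complete_play_def in_set_conv_nth nth_eq_iff_index_eq)

text \<open>After Maker's opening move the play splits into rounds in which Breaker moves first, so
  the bound is imposed on positions with one Maker point. It persists to the end, whereas a
  completed block alone would weigh 1.\<close>

lemma Breaker_wins:
  assumes "finite X" "X \<noteq> {}" "\<And>b. b \<in> \<F> \<Longrightarrow> b \<subseteq> X"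
    and init: "\<And>x. x \<in> X \<Longrightarrow> potential \<F> {x} {} < 1"
  shows "breaker_has_winning_strategy X \<F>"
proof -
  have fin: "finite \<F>" "\<And>b. b \<in> \<F> \<Longrightarrow> finite b"
    using finite_subset[of \<F> "Pow X"] finite_subset[OF _ \<open>finite X\<close>] assms by blast+
  let ?P = "\<lambda>p. potential \<F> (maker_points p) (breaker_points p)"
  have "\<not> (\<exists>b\<in>\<F>. b \<subseteq> maker_points p)"
    if p: "complete_play X p" and follows: "breaker_follows (greedy X \<F>) p" for p
  proof -
    have nonempty: "length p > 0" using assms p by (auto simp: complete_play_def)
    \<comment> \<open>The invariant is kept at odd lengths, where Breaker is to move.\<close>
    have odd_less: "?P (take (2 * t + 1) p) < 1" if "2 * t + 1 \<le> length p" for t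
      using that
    proof (induction t)
      case 0
      from nonempty have "take 1 p = [] @ [p ! 0]" by (cases p) auto
      then have "?P (take 1 p) = potential \<F> {p ! 0} {}"
        by (simp only: maker_points_snoc breaker_points_snoc) simp
      then show ?case
        using init[of "p ! 0"] p nonempty by (auto simp: complete_play_def)
    next
      case (Suc t)
      define q where "q = take (2 * t + 1) p"
      define z where "z = p ! (2 * t + 1)"
      define y where "y = p ! (2 * t + 2)"
      have len: "length q = 2 * t + 1" using Suc.prems by (simp add: q_def)
      have take1: "take (2 * t + 2) p = q @ [z]"
        using Suc.prems by (simp add: q_def z_def flip: take_Suc_conv_app_nth)
      have take2: "take (2 * Suc t + 1) p = (q @ [z]) @ [y]"
        using Suc.prems take_Suc_conv_app_nth[of "2 * t + 2" p] take1 by (simp add: y_def)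
      have z: "z = greedy X \<F> q"
        using follows Suc.prems by (simp add: breaker_follows_def z_def q_def)
      have y: "y \<in> X - set (q @ [z])"
        using complete_play_nth_fresh[OF p, of "2 * t + 2"] Suc.prems
        unfolding take1 y_def by auto
      \<comment> \<open>Maker's reply \<open>y\<close> was still free when Breaker preferred
        \<open>z\<close>.\<close>
      then have y_max: "potential (through y \<F>) (maker_points q) (breaker_points q)
          \<le> potential (through z \<F>) (maker_points q) (breaker_points q)"
        unfolding z by (intro greedy_max assms) auto
      have "y \<notin> maker_points q" using y maker_Un_breaker_points[of q] by auto
      \<comment> \<open>In \<open>potential_round\<close> the gain through \<open>y\<close> is at
        most the loss through \<open>z\<close>, and the pair term only lowers the total.\<close>
      then have "?P (take (2 * Suc t + 1) p) \<le> ?P q"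
        using y_max potential_nonneg[of "through y (through z \<F>)" "maker_points q" "breaker_points q"]
        unfolding take2 maker_points_snoc breaker_points_snoc
        by (simp add: len potential_round fin)
      also have "\<dots> < 1" using Suc by (simp add: q_def)
      finally show ?case .
    qed
    have final: "?P p < 1"
    proof (cases "odd (length p)")
      case True
      then obtain t where "length p = 2 * t + 1" by (elim oddE)
      with odd_less[of t] show ?thesis by simp
    next
      \<comment> \<open>With an even number of points Breaker makes an unanswered last move, which
        cannot raise the potential.\<close>
      case False
      with nonempty obtain t where t: "length p = Suc (2 * t + 1)"
        by (metis Suc_eq_plus1 Suc_pred even_Suc oddE)
      define q where "q = take (2 * t + 1) p"
      have pq: "p = q @ [p ! (2 * t + 1)]"
        using take_Suc_conv_app_nth[of "2 * t + 1" p] t by (simp add: q_def)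
      have "length q = 2 * t + 1" using t by (simp add: q_def)
      then have "?P p \<le> ?P q"
        by (subst (1 2) pq) (simp add: maker_points_snoc breaker_points_snoc
            potential_breaker_move fin potential_nonneg)
      also have "\<dots> < 1" using odd_less[of t] t by (simp add: q_def)
      finally show ?thesis .
    qed
    show ?thesis
    proof
      assume "\<exists>b\<in>\<F>. b \<subseteq> maker_points p"
      then obtain b where b: "b \<in> \<F>" "b \<subseteq> maker_points p" by blast
      \<comment> \<open>A block owned by Maker is untouched by Breaker and lacks no point, so it
        contributes \<open>(1/2) ^ 0 = 1\<close>.\<close>
      have "b \<inter> breaker_points p = {}"
        using b p maker_Int_breaker_points[of p] by (auto simp: complete_play_def)
      then have "(1/2) ^ card (b - maker_points p) \<le> ?P p"
        unfolding potential_def using b fin by (intro member_le_sum) auto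
      moreover have "b - maker_points p = {}" using b by auto
      ultimately show False using final by simp
    qed
  qed
  moreover have "breaker_strategy X (greedy X \<F>)"
    using assms greedy_in unfolding breaker_strategy_def by blast
  ultimately show ?thesis
    unfolding breaker_has_winning_strategy_def breaker_wins_play_def by blast
qed

text \<open>Each round of Maker's move and Breaker's reply costs at most \<open>D / 4\<close>, and
  there are at most \<open>card X / 2\<close> full rounds; this is the source of the 8. Positive
  potential on a full board means a block wholly owned by Maker.\<close>

lemma Maker_wins:
  assumes "finite X" "\<And>b. b \<in> \<F> \<Longrightarrow> b \<subseteq> X"
    and pair: "\<And>x y. x \<in> X \<Longrightarrow> y \<in> X \<Longrightarrow> x \<noteq> y \<Longrightarrow> card (through x (through y \<F>)) \<le> D"
    and init: "potential \<F> {} {} > real D * real (card X) / 8"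
  shows "maker_has_winning_strategy X \<F>"
proof -
  have fin: "finite \<F>" "\<And>b. b \<in> \<F> \<Longrightarrow> finite b"
    using finite_subset[of \<F> "Pow X"] finite_subset[OF _ \<open>finite X\<close>] assms by blast+
  let ?P = "\<lambda>p. potential \<F> (maker_points p) (breaker_points p)"
  have "maker_wins_play \<F> p"
    if p: "complete_play X p" and follows: "maker_follows (greedy X \<F>) p" for p
  proof -
    have length_p: "length p = card X"
      using p distinct_card[of p] by (auto simp: complete_play_def)
    have even_ge: "?P (take (2 * t) p) \<ge> potential \<F> {} {} - real D * real t / 4"
      if "2 * t \<le> length p" for t
      using that
    proof (induction t)
      case (Suc t)
      define q where "q = take (2 * t) p"
      define y where "y = p ! (2 * t)"
      define z where "z = p ! (2 * t + 1)"
      have len: "length q = 2 * t" using Suc.prems by (simp add: q_def)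
      have take1: "take (2 * t + 1) p = q @ [y]"
        using Suc.prems by (simp add: q_def y_def flip: take_Suc_conv_app_nth)
      have take2: "take (2 * Suc t) p = (q @ [y]) @ [z]"
        using Suc.prems take_Suc_conv_app_nth[of "2 * t + 1" p] take1 by (simp add: z_def)
      have y: "y = greedy X \<F> q"
        using follows Suc.prems by (simp add: maker_follows_def y_def q_def)
      have y_new: "y \<in> X - set q"
        using complete_play_nth_fresh[OF p, of "2 * t"] Suc.prems by (simp add: y_def q_def)
      have z: "z \<in> X - set (q @ [y])"
        using complete_play_nth_fresh[OF p, of "2 * t + 1"] Suc.prems
        unfolding take1 z_def by auto
      \<comment> \<open>Breaker's reply \<open>z\<close> was available to Maker, who preferred
        \<open>y\<close>; only the pair term can then lower the potential.\<close>
      then have z_max: "potential (through z \<F>) (maker_points q) (breaker_points q)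
          \<le> potential (through y \<F>) (maker_points q) (breaker_points q)"
        unfolding y by (intro greedy_max assms) auto
      have notin: "y \<notin> maker_points q" "z \<notin> maker_points q"
        using y_new z maker_Un_breaker_points[of q] by auto
      have "potential (through y (through z \<F>)) (maker_points q) (breaker_points q) \<le> real D / 4"
        using fin notin y_new z by (intro potential_through_pair_le pair) auto
      moreover have "?P (take (2 * Suc t) p) = ?P q
          + potential (through y \<F>) (maker_points q) (breaker_points q)
          - potential (through z \<F>) (maker_points q) (breaker_points q)
          - potential (through y (through z \<F>)) (maker_points q) (breaker_points q)"
        unfolding take2 maker_points_snoc breaker_points_snoc
        using notin by (simp add: len potential_round fin)
      moreover have "?P q \<ge> potential \<F> {} {} - real D * real t / 4"
        using Suc by (simp add: q_def)
      ultimately show ?case using z_max by (simp add: field_simps)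
    qed simp
    have pos: "?P (take (2 * t) p) > 0" if "2 * t \<le> length p" for t
    proof -
      have "real (2 * t) \<le> real (card X)" using that length_p by (simp only: of_nat_le_iff)
      then have "real D * real (2 * t) \<le> real D * real (card X)"
        by (intro mult_left_mono) auto
      then show ?thesis using even_ge[OF that] init by simp
    qed
    have final: "?P p > 0"
    proof (cases "even (length p)")
      case True
      then obtain t where "length p = 2 * t" by (elim evenE)
      with pos[of t] show ?thesis by simp
    next
      \<comment> \<open>With an odd number of points Maker makes the last move alone, which cannot
        lower the potential.\<close>
      case False
      then obtain t where t: "length p = 2 * t + 1" by (elim oddE)
      define q where "q = take (2 * t) p"
      define y where "y = p ! (2 * t)"
      have pq: "p = q @ [y]"
        using take_Suc_conv_app_nth[of "2 * t" p] t by (simp add: q_def y_def)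
      have "y \<notin> maker_points q"
        using complete_play_nth_fresh[OF p, of "2 * t"] t maker_Un_breaker_points[of q]
        by (auto simp: q_def y_def)
      moreover have "length q = 2 * t" using t by (simp add: q_def)
      ultimately have "?P p = ?P q + potential (through y \<F>) (maker_points q) (breaker_points q)"
        unfolding pq by (simp add: maker_points_snoc breaker_points_snoc potential_maker_move fin)
      then show ?thesis
        using pos[of t] t potential_nonneg[of "through y \<F>" "maker_points q" "breaker_points q"]
        by (simp add: q_def)
    qed
    \<comment> \<open>A positive sum has at least one summand. As every point has been chosen, all
      points of this block are Maker's.\<close>
    then obtain b where b: "b \<in> \<F>" "b \<inter> breaker_points p = {}"
      unfolding potential_def by (metis (mono_tags, lifting) less_irrefl mem_Collect_eq sum.neutral)
    then have "b \<subseteq> maker_points p"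
      using assms(2)[OF b(1)] p maker_Un_breaker_points[of p] by (auto simp: complete_play_def)
    with b show ?thesis unfolding maker_wins_play_def by (intro exI[of _ "length p"]) auto
  qed
  moreover have "maker_strategy X (greedy X \<F>)"
    using assms greedy_in unfolding maker_strategy_def by blast
  ultimately show ?thesis unfolding maker_has_winning_strategy_def by blast
qed

section \<open>Counting blocks\<close>

context transversal_design
begin

lemma finite_groups: "finite groups"
  using finite_points partition_groups by (metis finite_elements)

lemma finite_blocks: "finite blocks"
  using finite_points block_subset by (meson PowI finite_Pow_iff finite_subset subsetI)

lemma finite_block: "b \<in> blocks \<Longrightarrow> finite b"
  using finite_points block_subset finite_subset by metis

lemma group_subset: "g \<in> groups \<Longrightarrow> g \<subseteq> X"
  using partition_groups by (auto simp: partition_on_def)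

lemma groups_disjoint: "g \<in> groups \<Longrightarrow> h \<in> groups \<Longrightarrow> x \<in> g \<Longrightarrow> x \<in> h \<Longrightarrow> g = h"
  using partition_groups unfolding partition_on_def disjoint_def by blast

text \<open>Pigeonhole: the \<open>k\<close> points of a block lie in the \<open>k\<close> groups,
  at most one in each, so no group can be missed.\<close>

lemma ex1_block_point_in_group:
  assumes b: "b \<in> blocks" and g: "g \<in> groups"
  shows "\<exists>!x. x \<in> b \<and> x \<in> g"
proof -
  have le1: "card (b \<inter> h) \<le> 1" if "h \<in> groups" for h
    using block_meets_group[OF b that] finite_block[OF b]
    by (subst card_le_Suc0_iff_eq[unfolded One_nat_def[symmetric]]) auto
  have "b \<inter> g \<noteq> {}"
  proof
    assume empty: "b \<inter> g = {}"
    have "b = (\<Union>h\<in>groups - {g}. b \<inter> h)"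
      using block_subset[OF b] partition_groups empty unfolding partition_on_def by blast
    then have "card b \<le> (\<Sum>h\<in>groups - {g}. card (b \<inter> h))"
      using card_UN_le[of "groups - {g}" "\<lambda>h. b \<inter> h"] finite_groups by auto
    also have "\<dots> \<le> (\<Sum>h\<in>groups - {g}. 1)"
      using le1 by (intro sum_mono) auto
    also have "\<dots> < k"
      using card_Diff1_less[OF finite_groups g] card_groups by simp
    finally show False using card_block[OF b] by simp
  qed
  then show ?thesis using block_meets_group[OF b g] by auto
qed

lemma ex1_block_through:
  assumes "g \<in> groups" "h \<in> groups" "g \<noteq> h" "x \<in> g" "y \<in> h"
  shows "\<exists>!b. b \<in> blocks \<and> x \<in> b \<and> y \<in> b"
proof (rule pair_in_unique_block)
  show "x \<in> X" "y \<in> X" using assms group_subset by auto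
  show "\<not> (\<exists>f\<in>groups. x \<in> f \<and> y \<in> f)" using assms groups_disjoint by metis
qed

text \<open>Points in different groups share exactly one block, points in a common group share none.
  This supplies \<open>D = 1\<close> for Maker's criterion.\<close>

lemma card_through_pair:
  assumes "x \<in> X" "y \<in> X" "x \<noteq> y"
  shows "card (through x (through y blocks)) \<le> 1"
proof -
  have "b = c" if "b \<in> blocks" "c \<in> blocks" "{x, y} \<subseteq> b" "{x, y} \<subseteq> c" for b c
    using that pair_in_unique_block[OF assms(1,2)] block_meets_group[OF that(1)] assms(3)
    by (metis empty_subsetI insert_subset)
  then show ?thesis
    using finite_blocks
    by (subst card_le_Suc0_iff_eq[unfolded One_nat_def[symmetric]]) (auto simp: through_def)
qed

text \<open>As \<open>k \<ge> 2\<close>, there is a group \<open>h\<close> not containing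
  \<open>x\<close>. Sending a block through \<open>x\<close> to its point in \<open>h\<close> is a
  bijection onto \<open>h\<close>, because \<open>x\<close> and a point of \<open>h\<close>
  determine one block.\<close>

lemma card_through:
  assumes "k \<ge> 2" "x \<in> X"
  shows "card (through x blocks) = n"
proof -
  obtain g where g: "g \<in> groups" "x \<in> g"
    using assms partition_groups by (auto simp: partition_on_def)
  obtain h where h: "h \<in> groups" "h \<noteq> g"
    using assms card_groups finite_groups g
    by (metis card_le_Suc0_iff_eq not_less_eq_eq numeral_2_eq_2)
  define point where "point b = (THE y. y \<in> b \<and> y \<in> h)" for b
  have point: "point b \<in> b \<and> point b \<in> h" if "b \<in> blocks" for b
    unfolding point_def by (rule theI') (rule ex1_block_point_in_group[OF that h(1)])
  have "bij_betw point (through x blocks) h"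
  proof (rule bij_betwI')
    fix b c assume "b \<in> through x blocks" "c \<in> through x blocks"
    then have *: "b \<in> blocks \<and> x \<in> b" "c \<in> blocks \<and> x \<in> c" by (auto simp: through_def)
    then show "point b = point c \<longleftrightarrow> b = c"
      using point[of b] point[of c] ex1_block_through[OF g(1) h(1) h(2)[symmetric] g(2), of "point b"]
      by metis
  next
    fix y assume y: "y \<in> h"
    then obtain b where "b \<in> blocks" "x \<in> b" "y \<in> b"
      using ex1_block_through[OF g(1) h(1) h(2)[symmetric] g(2)] by blast
    then show "\<exists>b\<in>through x blocks. y = point b"
      using y point[of b] ex1_block_point_in_group[of b h] h
      by (intro bexI[of _ b]) (auto simp: through_def)
  qed (auto simp: through_def point)
  then show ?thesis using card_group h by (simp add: bij_betw_same_card)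
qed

text \<open>The \<open>n\<close> points of a fixed group sort the blocks into disjoint classes of
  size \<open>n\<close>, since each block meets the group exactly once.\<close>

lemma card_blocks:
  assumes "k \<ge> 2"
  shows "card blocks = n\<^sup>2"
proof -
  obtain g where g: "g \<in> groups"
    using assms card_groups by (metis all_not_in_conv card.empty not_numeral_le_zero)
  have "blocks = (\<Union>x\<in>g. through x blocks)"
    using ex1_block_point_in_group[OF _ g] unfolding through_def by blast
  also have "card \<dots> = (\<Sum>x\<in>g. card (through x blocks))"
  proof (rule card_UN_disjoint)
    show "finite g" using g group_subset finite_points finite_subset by metis
    show "\<forall>x\<in>g. finite (through x blocks)" using finite_blocks by simp
    show "\<forall>x\<in>g. \<forall>y\<in>g. x \<noteq> y \<longrightarrow> through x blocks \<inter> through y blocks = {}"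
      using ex1_block_point_in_group[OF _ g] unfolding through_def by blast
  qed
  also have "\<dots> = (\<Sum>x\<in>g. n)"
    using group_subset[OF g] by (intro sum.cong) (auto simp: card_through[OF assms])
  also have "\<dots> = n\<^sup>2" using card_group[OF g] by (simp add: power2_eq_square)
  finally show ?thesis .
qed

text \<open>Used for all blocks and for the blocks through Maker's first point.\<close>

lemma potential_subset_blocks:
  assumes "\<F> \<subseteq> blocks"
  shows "potential \<F> {} {} = real (card \<F>) / 2 ^ k"
proof -
  have "potential \<F> {} {} = (\<Sum>b\<in>\<F>. (1/2) ^ k)"
    unfolding potential_def using assms card_block by (intro sum.cong) auto
  then show ?thesis by (simp add: power_one_over)
qed

end

section \<open>The two numerical thresholds\<close>

theorem corollary2p6:
  fixes k n :: nat and X :: "'a set" and groups blocks :: "'a set set"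
  assumes "k \<ge> 2" and "n \<ge> 1"
    and "transversal_design k n X groups blocks"
  shows "(real n \<le> 2 powr (real k / 2) - 1 / 2 \<longrightarrow> breaker_has_winning_strategy X blocks) \<and>
    (real n > real k * 2 powr (real k - 3) \<longrightarrow> maker_has_winning_strategy X blocks)"
proof (intro conjI impI)
  interpret transversal_design k n X groups blocks by fact
  have total: "potential blocks {} {} = (real n)\<^sup>2 / 2 ^ k"
    using potential_subset_blocks[of blocks] card_blocks[OF assms(1)] by simp
  {
    assume le: "real n \<le> 2 powr (real k / 2) - 1 / 2"
    \<comment> \<open>Completing the square explains the 1/2:
      \<open>n^2 + n = (n + 1/2)^2 - 1/4\<close>, which is at most \<open>2^k - 1/4\<close>.\<close>
    have "(real n + 1/2)\<^sup>2 \<le> (2 powr (real k / 2))\<^sup>2"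
      using le by (intro power_mono) auto
    also have "\<dots> = 2 ^ k"
      by (simp add: power2_eq_square powr_realpow flip: powr_add)
    finally have "((real n)\<^sup>2 + real n) / 2 ^ k < 1"
      by (simp add: power2_eq_square field_simps)
    \<comment> \<open>The opening move doubles the weight of the \<open>n\<close> blocks through
      \<open>x\<close>, adding \<open>n / 2^k\<close>.\<close>
    moreover have "potential blocks {x} {} = ((real n)\<^sup>2 + real n) / 2 ^ k" if "x \<in> X" for x
      using potential_maker_move[of blocks x "{}" "{}"] finite_blocks finite_block total
        potential_subset_blocks[of "through x blocks"] card_through[OF assms(1) that]
      by (simp add: through_def add_divide_distrib)
    moreover have "X \<noteq> {}" using card_points assms by auto
    ultimately show "breaker_has_winning_strategy X blocks"
      by (intro Breaker_wins[OF finite_points _ block_subset]) simp_all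
  next
    assume gt: "real n > real k * 2 powr (real k - 3)"
    have "2 powr (real k - 3) = (2::real) ^ k / 8"
      by (simp add: powr_diff powr_realpow)
    \<comment> \<open>Multiplying the hypothesis by \<open>n\<close> turns it into
      \<open>k * n / 8 < n^2 / 2^k\<close>, Maker's criterion with \<open>D = 1\<close> and
      \<open>k * n\<close> points.\<close>
    with gt have "real n * (real k * 2 ^ k / 8) < real n * real n"
      using assms by (intro mult_strict_left_mono) auto
    then have "real k * real n / 8 * 2 ^ k < (real n)\<^sup>2"
      by (simp add: power2_eq_square mult_ac)
    then have "real k * real n / 8 < (real n)\<^sup>2 / 2 ^ k"
      by (subst pos_less_divide_eq) simp_all
    then have "potential blocks {} {} > real 1 * real (card X) / 8"
      by (simp add: total card_points)
    then show "maker_has_winning_strategy X blocks"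
      using Maker_wins[OF finite_points block_subset card_through_pair] by blast
  }
qed

end
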